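(* The sharp $\mathscr{S}^*_\wp$-radii are: (i) $R_{\mathscr{S}^*_\wp}(\mathcal{S}^*_L)=(2e-1)/e^2\approx0.600423$; (ii) $R_{\mathscr{S}^*_\wp}(\mathcal{S}^*_{RL})=\dfrac{1+2(\sqrt2-1)e}{e^2(\sqrt2-1)\left(\sqrt2-1+2(\sqrt2-1+e^{-1})^2\right)}\approx0.648826$; (iii) $R_{\mathscr{S}^*_\wp}(\mathcal{S}^*_e)=1-\ln(e-1)\approx0.458675$; (iv) $R_{\mathscr{S}^*_\wp}(\mathcal{S}^*_C)=1-\sqrt{1-3/(2e)}\approx0.330536$; (v) $R_{\mathscr{S}^*_\wp}(\mathcal{S}^*_s)=\arcsin(1/e)\approx0.376727$; (vi) $R_{\mathscr{S}^*_\wp}(\Delta^* )=(2e-1)/(2e(e-1))\approx0.474928$.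
   Context: $\mathbb{D}$ is the unit disk; $\mathcal{A}$ is the class of analytic $f$ on $\mathbb{D}$ with $f(0)=0,f'(0)=1$. $f\prec g$ means $f=g\circ\omega$ for analytic $\omega:\mathbb{D}\to\mathbb{D}$, $\omega(0)=0$. For analytic $\psi$, $\mathcal{S}^*(\psi)=\{f\in\mathcal{A}:zf'/f\prec\psi\}$. $\wp(z)=1+ze^z$, $\mathscr{S}^*_\wp=\mathcal{S}^*(\wp)$. Further $\mathcal{S}^*_L=\mathcal{S}^*(\sqrt{1+z})$, $\mathcal{S}^*_{RL}=\mathcal{S}^*\big(\sqrt2-(\sqrt2-1)\sqrt{(1-z)/(1+2(\sqrt2-1)z)}\big)$, $\mathcal{S}^*_e=\mathcal{S}^*(e^z)$, $\mathcal{S}^*_C=\mathcal{S}^*(1+\tfrac43z+\tfrac23z^2)$, $\mathcal{S}^*_s=\mathcal{S}^*(1+\sin z)$, $\Delta^*=\mathcal{S}^*(z+\sqrt{1+z^2})$ (principal branches). For classes $G_1,G_2$, $R_{G_1}(G_2)$ is the largest $r_0\in(0,1]$ such that $r^{-1}f(rz)\in G_1$ for all $0<r\le r_0$ and all $f\in G_2$; "sharp" means it cannot be increased. *)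

theory Defs
  imports "HOL-Analysis.Analysis"
begin

definition classA :: "(complex \<Rightarrow> complex) \<Rightarrow> bool" where
  "classA f \<longleftrightarrow> f holomorphic_on ball 0 1 \<and> f 0 = 0 \<and> deriv f 0 = 1"

definition subord :: "(complex \<Rightarrow> complex) \<Rightarrow> (complex \<Rightarrow> complex) \<Rightarrow> bool" where
  "subord p g \<longleftrightarrow> (\<exists>\<omega>. \<omega> holomorphic_on ball 0 1 \<and> \<omega> ` ball 0 1 \<subseteq> ball 0 1 \<and> \<omega> 0 = 0 \<and>
       (\<forall>z\<in>ball 0 1. p z = g (\<omega> z)))"

text \<open>The function z f'(z)/f(z), with its removable value 1 at z = 0.\<close>
definition logderiv_q :: "(complex \<Rightarrow> complex) \<Rightarrow> complex \<Rightarrow> complex" where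
  "logderiv_q f z = (if z = 0 then 1 else z * deriv f z / f z)"

text \<open>S*(psi). Analyticity of z f'/f on the disk forces f z \<noteq> 0 for z \<noteq> 0, which we require explicitly.\<close>
definition starlike_class :: "(complex \<Rightarrow> complex) \<Rightarrow> (complex \<Rightarrow> complex) set" where
  "starlike_class \<psi> = {f. classA f \<and> (\<forall>z\<in>ball 0 1. z \<noteq> 0 \<longrightarrow> f z \<noteq> 0) \<and>
        subord (logderiv_q f) \<psi>}"

definition wp :: "complex \<Rightarrow> complex" where "wp z = 1 + z * exp z"
definition psiL :: "complex \<Rightarrow> complex" where "psiL z = csqrt (1 + z)"
definition psiRL :: "complex \<Rightarrow> complex" where
  "psiRL z = complex_of_real (sqrt 2) - complex_of_real (sqrt 2 - 1) *
      csqrt ((1 - z) / (1 + 2 * complex_of_real (sqrt 2 - 1) * z))"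
definition psiE :: "complex \<Rightarrow> complex" where "psiE z = exp z"
definition psiC :: "complex \<Rightarrow> complex" where "psiC z = 1 + 4/3 * z + 2/3 * z^2"
definition psiS :: "complex \<Rightarrow> complex" where "psiS z = 1 + sin z"
definition psiDelta :: "complex \<Rightarrow> complex" where "psiDelta z = z + csqrt (1 + z^2)"

definition rescale :: "real \<Rightarrow> (complex \<Rightarrow> complex) \<Rightarrow> complex \<Rightarrow> complex" where
  "rescale r f = (\<lambda>z. f (complex_of_real r * z) / complex_of_real r)"

definition radius_good :: "(complex \<Rightarrow> complex) set \<Rightarrow> (complex \<Rightarrow> complex) set \<Rightarrow> real \<Rightarrow> bool" where
  "radius_good G1 G2 r0 \<longleftrightarrow> (\<forall>r. 0 < r \<and> r \<le> r0 \<longrightarrow> (\<forall>f\<in>G2. rescale r f \<in> G1))"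

definition is_radius :: "(complex \<Rightarrow> complex) set \<Rightarrow> (complex \<Rightarrow> complex) set \<Rightarrow> real \<Rightarrow> bool" where
  "is_radius G1 G2 R \<longleftrightarrow> 0 < R \<and> R \<le> 1 \<and> radius_good G1 G2 R \<and>
      (\<forall>r0. 0 < r0 \<and> r0 \<le> 1 \<and> radius_good G1 G2 r0 \<longrightarrow> r0 \<le> R)"

end

theory Submission
  imports Defs "HOL-Complex_Analysis.Complex_Analysis"
begin

text \<open>
  The function \<open>h z = z e\<^sup>z\<close> is injective on the unit disk, and \<open>\<bar>h v - 1\<bar> \<ge> 1 + 1/e\<close> for \<open>\<bar>v\<bar> = 1\<close>, with
  equality at \<open>v = -1\<close>. By connectedness the image of the disk under \<open>wp\<close> therefore contains the
  disk \<open>\<bar>w - 2\<bar> < 1 + 1/e\<close>, whose boundary touches that of the image at \<open>1 - 1/e\<close>. By Schwarz' lemma,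
  \<open>R\<close> is the sharp radius for \<open>S*(\<psi>)\<close> as soon as \<open>\<psi>\<close> maps \<open>\<bar>z\<bar> < R\<close> into that disk and
  \<open>\<psi> (-R) = 1 - 1/e\<close>; the extremal function is the \<open>f\<close> with \<open>z f'/f = \<psi>\<close>. All six classes have
  this shape, and each \<open>R\<close> is found by solving \<open>\<psi> (-R) = 1 - 1/e\<close>.
\<close>

subsection \<open>Elementary estimates\<close>

lemma cos_ge_quadratic: "1 - x\<^sup>2 / 2 \<le> cos x" for x :: real
proof -
  have "cos x = 1 - 2 * (sin (x / 2))\<^sup>2"
    using cos_double_sin[of "x / 2"] by simp
  moreover have "(sin (x / 2))\<^sup>2 \<le> (x / 2)\<^sup>2"
    using abs_sin_x_le_abs_x[of "x / 2"] by (simp only: abs_le_square_iff)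
  ultimately show ?thesis by (simp add: power2_eq_square)
qed

text \<open>The cubic Taylor bound for \<open>sin\<close> is multiplied by \<open>x\<close>: both
  sides become even, so the sign of \<open>x\<close> does not matter.\<close>

lemma times_sin_ge_quartic: "x\<^sup>2 - x ^ 4 / 6 \<le> x * sin x" for x :: real
proof -
  have "\<bar>sin x - x\<bar> \<le> \<bar>x\<bar> ^ 3 / 6"
    using Maclaurin_sin_bound[of x 3]
    by (simp add: numeral_3_eq_3 sin_coeff_def fact_numeral divide_simps)
  then have "\<bar>x\<bar> * \<bar>sin x - x\<bar> \<le> \<bar>x\<bar> * (\<bar>x\<bar> ^ 3 / 6)"
    by (rule mult_left_mono) simp
  also have "\<bar>x\<bar> * (\<bar>x\<bar> ^ 3 / 6) = x ^ 4 / 6"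
    by (simp add: power4_eq_xxxx power3_eq_cube abs_if)
  finally have "\<bar>x * sin x - x\<^sup>2\<bar> \<le> x ^ 4 / 6"
    by (simp add: abs_mult[symmetric] algebra_simps power2_eq_square)
  then show ?thesis by linarith
qed

lemma exp_one_gt: "exp 1 > (27 / 10 :: real)"
  using e_approx_32 by (simp add: abs_if split: if_split_asm)

text \<open>These rational bounds decide numerical comparisons in the proofs of all six
  radii.\<close>

lemma exp_minus_one_bounds:
  "0 < exp (- 1 :: real)" "9 / 25 < exp (- 1 :: real)" "exp (- 1 :: real) < 10 / 27"
  using exp_one_gt e_less_272 by (auto simp: exp_minus field_simps)

subsection \<open>The map \<open>z e\<^sup>z\<close> on the unit disk\<close>

text \<open>Mean value inequality on the left half-plane: it is convex, and the derivative
  \<open>exp\<close> has modulus at most 1 there.\<close>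

lemma norm_exp_minus_one_le:
  assumes "Re u \<le> 0"
  shows "norm (exp u - 1) \<le> norm u"
proof -
  have "norm (exp u - exp 0) \<le> 1 * norm (u - 0)"
  proof (rule field_differentiable_bound[where f' = exp])
    show "convex {z. Re z \<le> 0}" by (rule convex_halfspace_Re_le)
  qed (use assms in \<open>auto intro!: derivative_eq_intros\<close>)
  then show ?thesis by simp
qed

text \<open>Strictness comes from halving the argument: in the factorisation of
  \<open>exp u - 1\<close> through \<open>exp (u / 2)\<close>, one factor is at most |u|/2 and the
  other is strictly below 2.\<close>

lemma norm_exp_minus_one_less:
  assumes "Re u < 0"
  shows "norm (exp u - 1) < norm u"
proof -
  have "exp u - 1 = (exp (u / 2) - 1) * (exp (u / 2) + 1)"
    by (simp add: algebra_simps flip: exp_add)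
  then have "norm (exp u - 1) = norm (exp (u / 2) - 1) * norm (exp (u / 2) + 1)"
    by (metis norm_mult)
  also have "\<dots> \<le> norm (u / 2) * norm (exp (u / 2) + 1)"
    using norm_exp_minus_one_le[of "u / 2"] assms by (intro mult_right_mono) auto
  also have "\<dots> < norm (u / 2) * 2"
  proof (rule mult_strict_left_mono)
    have "norm (exp (u / 2) + 1) \<le> exp (Re u / 2) + 1"
      using norm_triangle_ineq[of "exp (u / 2)" 1] by simp
    also have "\<dots> < 2" using assms by simp
    finally show "norm (exp (u / 2) + 1) < 2" .
  qed (use assms in auto)
  finally show ?thesis by simp
qed

text \<open>With \<open>u = w - z\<close> the equation reads \<open>- u = w * (exp u - 1)\<close>,
  and \<open>Re u \<le> 0\<close>. Since |exp u - 1| is at most |u|, a nonzero \<open>u\<close> is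
  impossible once one of the two factors is strictly smaller than its bound. The second alternative
  of \<open>strict\<close> admits boundary points such as \<open>w = -1\<close>.\<close>

lemma times_exp_eqD:
  assumes eq: "z * exp z = w * exp w" and w: "norm w \<le> 1" and re: "Re w \<le> Re z"
    and strict: "norm w < 1 \<or> Re w < Re z"
  shows "z = w"
proof (rule ccontr)
  assume "z \<noteq> w"
  define u where "u = w - z"
  have u: "u \<noteq> 0" "Re u \<le> 0"
    using \<open>z \<noteq> w\<close> re by (auto simp: u_def)
  have "z = w * exp u"
    using eq by (simp add: u_def exp_diff field_simps)
  then have "- u = w * (exp u - 1)"
    by (simp add: u_def algebra_simps)
  then have *: "norm u = norm w * norm (exp u - 1)"
    by (metis norm_minus_cancel norm_mult)
  show False
  proof (cases "norm w < 1")
    case True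
    have "norm w * norm (exp u - 1) \<le> norm w * norm u"
      by (intro mult_left_mono norm_exp_minus_one_le u) auto
    also have "\<dots> < 1 * norm u"
      using True u by (intro mult_strict_right_mono) auto
    finally show False using * by simp
  next
    case False
    then have "Re u < 0" using strict by (simp add: u_def)
    moreover have "norm w * norm (exp u - 1) \<le> 1 * norm (exp u - 1)"
      by (intro mult_right_mono w) auto
    ultimately show False using * norm_exp_minus_one_less[of u] by simp
  qed
qed

lemma inj_on_times_exp: "inj_on (\<lambda>z::complex. z * exp z) (ball 0 1)"
proof (rule inj_onI)
  fix z w :: complex
  assume "z \<in> ball 0 1" "w \<in> ball 0 1" "z * exp z = w * exp w"
  then show "z = w"
    using times_exp_eqD[of z w] times_exp_eqD[of w z] by (cases "Re w \<le> Re z") auto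
qed

text \<open>The value is attained at \<open>-1\<close>, which lies strictly to the left of every
  point of the disk, so \<open>times_exp_eqD\<close> would force \<open>v = -1\<close>. Hence
  \<open>wp\<close> omits 1 - 1/e on the disk, which yields sharpness of the radii.\<close>

lemma times_exp_ne_minus_inverse_e:
  assumes "norm (v::complex) < 1"
  shows "v * exp v \<noteq> - exp (- 1)"
proof
  assume "v * exp v = - exp (- 1)"
  moreover have "Re v > -1" using assms abs_Re_le_cmod[of v] by linarith
  ultimately have "v = -1" using times_exp_eqD[of v "-1"] by simp
  then show False using assms by simp
qed

text \<open>On the left half of the circle the real part of \<open>v * exp v\<close> alone is at
  most -1/e. On the right half there is room to spare: the squared distance is at least 2, which
  exceeds (1 + 1/e)^2.\<close>

lemma norm_times_exp_minus_one_ge: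
  assumes "norm (v::complex) = 1"
  shows "1 + exp (- 1) \<le> norm (v * exp v - 1)"
proof -
  define c s where "c = Re v" and "s = Im v"
  have cs: "c\<^sup>2 + s\<^sup>2 = 1"
    using assms by (simp add: c_def s_def cmod_def)
  then have "c\<^sup>2 \<le> 1" "s\<^sup>2 \<le> 1"
    using zero_le_power2[of c] zero_le_power2[of s] by linarith+
  then have c1: "\<bar>c\<bar> \<le> 1" and s1: "\<bar>s\<bar> \<le> 1"
    by (simp_all add: abs_square_le_1)
  define m where "m = c * cos s - s * sin s"
  have re: "Re (v * exp v) = exp c * m"
    by (simp add: c_def s_def m_def Re_exp Im_exp algebra_simps)
  show ?thesis
  proof (cases "c \<le> 0")
    case True
    define p where "p = - c"
    have p: "0 \<le> p" "p \<le> 1" using True c1 by (auto simp: p_def)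
    have s2: "s\<^sup>2 = 1 - p\<^sup>2" using cs by (simp add: p_def)
    have s4: "s ^ 4 = (1 - p\<^sup>2)\<^sup>2" by (simp flip: s2)
    \<comment> \<open>\<open>g\<close> is a polynomial minorant of \<open>- m\<close>. The goal
      \<open>exp (1 - p) * (- m) \<ge> 1\<close> follows from \<open>(2 - p) * g \<ge> 1\<close>,
      because \<open>exp (1 - p) \<ge> 2 - p\<close>.\<close>
    define g where "g = p * (1 - s\<^sup>2 / 2) + (s\<^sup>2 - s ^ 4 / 6)"
    have "g \<le> p * cos s + s * sin s"
      unfolding g_def using p
      by (intro add_mono mult_left_mono cos_ge_quadratic times_sin_ge_quartic)
    then have "g \<le> - m" by (simp add: m_def p_def)
    have g: "g = 5/6 + p/2 - 2/3 * p^2 + p^3/2 - p^4/6"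
      unfolding g_def s2 s4 by (simp add: field_simps power2_eq_square power3_eq_cube power4_eq_xxxx)
    \<comment> \<open>The factor \<open>1 - p\<close> reflects the equality at \<open>p = 1\<close>,
      that is, at \<open>v = -1\<close>.\<close>
    have "(2 - p) * g - 1 = (1 - p) * (1 - (1 - p) / 6 - (1 - p) ^ 4 / 6)"
      unfolding g by (simp add: field_simps power2_eq_square power3_eq_cube power4_eq_xxxx)
    moreover have "0 \<le> 1 - (1 - p) / 6 - (1 - p) ^ 4 / 6"
      using p power_le_one[of "1 - p" 4] by (simp add: field_simps)
    then have "0 \<le> (1 - p) * (1 - (1 - p) / 6 - (1 - p) ^ 4 / 6)"
      using p by (intro mult_nonneg_nonneg) auto
    ultimately have "(2 - p) * g \<ge> 1" by linarith
    then have "g > 0" using p mult_nonneg_nonpos[of "2 - p" g] by (cases "g > 0") auto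
    have "1 \<le> (2 - p) * g" by fact
    also have "\<dots> \<le> exp (1 - p) * g"
      using exp_ge_add_one_self[of "1 - p"] \<open>g > 0\<close> by (intro mult_right_mono) auto
    also have "\<dots> \<le> exp (1 - p) * (- m)"
      using \<open>g \<le> - m\<close> by (intro mult_left_mono) auto
    finally have "exp (- 1) * 1 \<le> exp (-1) * (exp (1 - p) * (- m))"
      by (intro mult_left_mono) auto
    also have "\<dots> = - (exp c * m)"
      by (simp add: p_def exp_add exp_minus)
    finally have "Re (v * exp v) \<le> - exp (- 1)" unfolding re by simp
    then have "1 + exp (-1) \<le> \<bar>Re (v * exp v - 1)\<bar>"
      unfolding minus_complex.sel one_complex.sel by linarith
    then show ?thesis using abs_Re_le_cmod[of "v * exp v - 1"] by linarith
  next
    case False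
    have "s * sin s \<ge> 0"
      using s1 sin_ge_zero[of s] sin_ge_zero[of "- s"] pi_gt3
      by (cases "s \<ge> 0") (auto simp: mult_nonpos_nonpos)
    moreover have "c * cos s \<le> c * 1" using False by (intro mult_left_mono) auto
    ultimately have "m \<le> c" by (simp add: m_def)
    have e: "1 + c + c\<^sup>2 / 2 \<le> exp c"
      using False by (intro exp_lower_Taylor_quadratic) simp
    have n: "norm (v * exp v) = exp c"
      using assms by (simp add: norm_mult c_def)
    \<comment> \<open>The quadratic Taylor polynomial bounds \<open>exp c\<close> from below, and
      after subtracting \<open>2 * c\<close> also \<open>exp c - 2 * c\<close>. The product of the
      two bounds is a difference of squares, equal to 1 + c^4/4.\<close>
    have "2 \<le> 1 + (1 + c\<^sup>2/2 + c) * (1 + c\<^sup>2/2 - c)"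
    proof -
      have "(1 + c\<^sup>2/2 + c) * (1 + c\<^sup>2/2 - c) = 1 + (c\<^sup>2 / 2)\<^sup>2"
        by (simp add: field_simps power2_eq_square)
      then show ?thesis by simp
    qed
    also have "(1 + c\<^sup>2/2 + c) * (1 + c\<^sup>2/2 - c) \<le> exp c * (exp c - 2 * c)"
      using e False c1 zero_le_power2[of c] by (intro mult_mono) linarith+
    also have "1 + exp c * (exp c - 2 * c) \<le> 1 + exp c * (exp c - 2 * m)"
      using \<open>m \<le> c\<close> by simp
    also have "\<dots> = (norm (v * exp v))\<^sup>2 - 2 * Re (v * exp v) + 1"
      by (simp only: n re) (simp add: algebra_simps power2_eq_square)
    also have "\<dots> = (norm (v * exp v - 1))\<^sup>2"
      unfolding cmod_power2 by (simp add: algebra_simps power2_eq_square)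
    finally have "2 \<le> (norm (v * exp v - 1))\<^sup>2" by simp
    moreover have "(1 + exp (-1 :: real))\<^sup>2 \<le> 2"
    proof -
      have "exp (-1 :: real) \<le> 10/27"
        using exp_one_gt by (simp add: exp_minus field_simps)
      then have "(1 + exp (-1 :: real))\<^sup>2 \<le> (1 + 10/27)\<^sup>2"
        by (intro power_mono) auto
      also have "\<dots> \<le> 2" by (simp add: power2_eq_square)
      finally show ?thesis .
    qed
    ultimately have "(1 + exp (-1))\<^sup>2 \<le> (norm (v * exp v - 1))\<^sup>2"
      by (rule order_trans[rotated])
    then show ?thesis by (rule power2_le_imp_le) simp
  qed
qed

lemma ball_subset_times_exp_image:
  "ball 1 (1 + exp (- 1)) \<subseteq> (\<lambda>z::complex. z * exp z) ` ball 0 1" (is "?B \<subseteq> ?h ` _")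
proof (rule ccontr)
  let ?U = "?h ` ball 0 1"
  assume "\<not> ?B \<subseteq> ?U"
  then have "?B - ?U \<noteq> {}" by blast
  moreover have "0 \<in> ?B \<inter> ?U"
    using exp_gt_zero[of "-1 :: real"] by (auto simp: image_iff intro!: bexI[of _ 0])
  ultimately have "?B \<inter> frontier ?U \<noteq> {}"
    by (metis connected_Int_frontier connected_ball empty_iff)
  then obtain w where w: "w \<in> ?B" "w \<in> frontier ?U" by blast
  have "open ?U"
    by (intro open_mapping_thm3 inj_on_times_exp holomorphic_intros) auto
  then have "w \<notin> ?U" using w by (simp add: frontier_def interior_open)
  have "closed (?h ` cball 0 1)"
    by (intro compact_imp_closed compact_continuous_image continuous_intros) auto
  then have "closure ?U \<subseteq> ?h ` cball 0 1"
    by (intro closure_minimal image_mono) auto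
  then obtain v where v: "norm v \<le> 1" "w = ?h v"
    using w by (auto simp: frontier_def)
  moreover have "\<not> norm v < 1" using v(2) \<open>w \<notin> ?U\<close> by auto
  ultimately have "norm v = 1" by simp
  then show False
    using norm_times_exp_minus_one_ge[of v] w v by (simp add: dist_norm norm_minus_commute)
qed

subsection \<open>A criterion for sharp radii\<close>

lemma scaled_in_unit_ball:
  assumes "0 < r" "r \<le> 1" "norm (z :: complex) < 1"
  shows "of_real r * z \<in> ball 0 1"
  using assms mult_le_less_imp_less[of r 1 "norm z" 1] by (cases "z = 0") (auto simp: norm_mult)

lemma deriv_rescale:
  assumes f: "f holomorphic_on ball 0 1" and r: "0 < r" "r \<le> 1" and z: "norm z < 1"
  shows "deriv (rescale r f) z = deriv f (of_real r * z)"
proof -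
  have "(f has_field_derivative deriv f (of_real r * z)) (at (of_real r * z))"
    using f scaled_in_unit_ball[OF r z] by (simp add: holomorphic_derivI)
  then have "((\<lambda>z. f (of_real r * z)) has_field_derivative of_real r * deriv f (of_real r * z)) (at z)"
    using DERIV_chain2[OF _ DERIV_cmult_Id[of "of_real r :: complex" z UNIV]]
    by (simp only: mult.commute[of "of_real r" "deriv f _"])
  from DERIV_cdivide[OF this, of "of_real r"]
  have "(rescale r f has_field_derivative deriv f (of_real r * z)) (at z)"
    using r by (simp add: rescale_def)
  then show ?thesis
    by (rule DERIV_imp_deriv)
qed

text \<open>The denominator \<open>r\<close> in \<open>rescale\<close> supplies the missing factor
  in front of the derivative. Radius problems thereby become questions about values on smaller
  disks.\<close>

lemma logderiv_q_rescale:
  assumes "f holomorphic_on ball 0 1" and "0 < r" "r \<le> 1" and "norm z < 1"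
  shows "logderiv_q (rescale r f) z = logderiv_q f (of_real r * z)"
  using assms by (simp add: logderiv_q_def deriv_rescale) (simp add: rescale_def)

lemma classA_rescale:
  assumes f: "classA f" and r: "0 < r" "r \<le> 1"
  shows "classA (rescale r f)"
proof -
  have hol: "f holomorphic_on ball 0 1" using f by (simp add: classA_def)
  have "(\<lambda>z. f (of_real r * z)) holomorphic_on ball 0 1"
    by (rule holomorphic_on_compose_gen[OF _ hol, unfolded o_def])
      (use scaled_in_unit_ball[OF r] in \<open>auto intro!: holomorphic_intros\<close>)
  then have "rescale r f holomorphic_on ball 0 1"
    unfolding rescale_def using r by (auto intro!: holomorphic_intros)
  then show ?thesis
    using f deriv_rescale[OF hol r, of 0] by (simp add: classA_def rescale_def)
qed

text \<open>The equation z f'/f = \<psi> is solved by z times the exponential of a primitive of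
  (\<psi>(z) - 1)/z. The singularity of this quotient at 0 is removable, with value
  \<open>deriv \<psi> 0\<close>, and subtracting \<open>G 0\<close> normalises
  \<open>deriv f 0\<close> to 1.\<close>

lemma exists_classA_logderiv_q:
  assumes psi: "\<psi> holomorphic_on ball 0 1" "\<psi> 0 = 1"
  obtains f where "classA f" "\<And>z. z \<in> ball 0 1 \<Longrightarrow> z \<noteq> 0 \<Longrightarrow> f z \<noteq> 0"
    "\<And>z. z \<in> ball 0 1 \<Longrightarrow> logderiv_q f z = \<psi> z"
proof -
  define q where "q = (\<lambda>z. if z = 0 then deriv \<psi> 0 else (\<psi> z - \<psi> 0) / (z - 0))"
  have "q holomorphic_on ball 0 1"
    unfolding q_def by (rule pole_lemma) (use psi in auto)
  then obtain G where G: "\<And>z. z \<in> ball 0 1 \<Longrightarrow> (G has_field_derivative q z) (at z within ball 0 1)"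
    by (rule holomorphic_convex_primitive'[OF convex_ball open_ball]) blast
  have q: "z * q z = \<psi> z - 1" for z
    by (cases "z = 0") (simp_all add: q_def psi(2))
  define f where "f = (\<lambda>z. z * exp (G z - G 0))"
  have df: "(f has_field_derivative \<psi> z * exp (G z - G 0)) (at z)" if "z \<in> ball 0 1" for z
  proof -
    have "(G has_field_derivative q z) (at z)"
      using G[OF that] by (simp only: at_within_open[OF that open_ball])
    then have "((\<lambda>z. G z - G 0) has_field_derivative q z - 0) (at z)"
      by (intro DERIV_diff DERIV_const)
    from DERIV_mult[OF DERIV_ident DERIV_fun_exp[OF this]]
    have "(f has_field_derivative exp (G z - G 0) + z * q z * exp (G z - G 0)) (at z)"
      by (simp add: f_def algebra_simps)
    then show ?thesis by (simp add: q algebra_simps)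
  qed
  have "f holomorphic_on ball 0 1"
    unfolding holomorphic_on_open[OF open_ball] using df by blast
  moreover have "deriv f 0 = 1"
    using DERIV_imp_deriv[OF df[of 0]] psi by simp
  ultimately have "classA f" by (simp add: classA_def f_def)
  moreover have "logderiv_q f z = \<psi> z" if "z \<in> ball 0 1" for z
    unfolding logderiv_q_def DERIV_imp_deriv[OF df[OF that]]
    using psi by (simp add: f_def)
  ultimately show ?thesis by (intro that[of f]) (auto simp: f_def)
qed

lemma is_radius_wpI:
  assumes R: "0 < R" "R \<le> 1"
    and hol: "\<psi> holomorphic_on ball 0 1" and psi0: "\<psi> 0 = 1"
    and bound: "\<And>z. norm z < R \<Longrightarrow> norm (\<psi> z - 2) < 1 + exp (- 1)"
    and sharp: "\<psi> (- of_real R) = 1 - exp (- 1)"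
  shows "is_radius (starlike_class wp) (starlike_class \<psi>) R"
proof -
  let ?h = "\<lambda>z::complex. z * exp z"
  obtain g where g: "g holomorphic_on (?h ` ball 0 1)" "\<And>z. z \<in> ball 0 1 \<Longrightarrow> g (?h z) = z"
    by (rule holomorphic_has_inverse[OF _ _ inj_on_times_exp]) (auto intro!: holomorphic_intros)
  have gh: "g w \<in> ball 0 1" "?h (g w) = w" if "w \<in> ball 1 (1 + exp (- 1))" for w
    using ball_subset_times_exp_image that g(2) by force+
  have "rescale r f \<in> starlike_class wp" if r: "0 < r" "r \<le> R" and f: "f \<in> starlike_class \<psi>" for r f
  proof -
    have r1: "r \<le> 1" using r R by simp
    have A: "classA f" and nz: "\<And>z. z \<in> ball 0 1 \<Longrightarrow> z \<noteq> 0 \<Longrightarrow> f z \<noteq> 0"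
      using f by (auto simp: starlike_class_def)
    then have fhol: "f holomorphic_on ball 0 1" by (simp add: classA_def)
    note in_ball = scaled_in_unit_ball[OF r(1) r1]
    obtain \<omega> where w: "\<omega> holomorphic_on ball 0 1" "\<omega> ` ball 0 1 \<subseteq> ball 0 1" "\<omega> 0 = 0"
      "\<And>z. z \<in> ball 0 1 \<Longrightarrow> logderiv_q f z = \<psi> (\<omega> z)"
      using f by (auto simp: starlike_class_def subord_def)
    \<comment> \<open>Schwarz gives |\<omega>(rz)| \<le> |rz| < r, a strict inequality, so
      \<open>bound\<close> on the open disk suffices even for r = R.\<close>
    have wR: "norm (\<omega> (of_real r * z)) < R" if "norm z < 1" for z
    proof -
      have "norm (\<omega> (of_real r * z)) \<le> norm (of_real r * z)"
        using w(2) in_ball[OF that] by (intro Schwarz_Lemma(1) w) force+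
      also have "\<dots> < r * 1" using that r by (simp add: norm_mult)
      finally show ?thesis using r by simp
    qed
    \<comment> \<open>\<open>W\<close> is z f'/f - 1 for the dilated function. Its values lie where
      the inverse \<open>g\<close> of \<open>?h\<close> is defined, so \<open>g (W z)\<close> serves
      as the subordinating function for \<open>wp\<close>.\<close>
    define W where "W = (\<lambda>z. \<psi> (\<omega> (of_real r * z)) - 1)"
    have Wball: "W z \<in> ball 1 (1 + exp (- 1))" if "z \<in> ball 0 1" for z
      using bound[OF wR[of z]] that
      by (simp add: W_def dist_norm norm_minus_commute)
    have 1: "(\<lambda>z. \<omega> (of_real r * z)) holomorphic_on ball 0 1"
      by (rule holomorphic_on_compose_gen[OF _ w(1), unfolded o_def])
        (use in_ball in \<open>auto intro!: holomorphic_intros\<close>)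
    have "(\<lambda>z. \<psi> (\<omega> (of_real r * z))) holomorphic_on ball 0 1"
      by (rule holomorphic_on_compose_gen[OF 1 hol, unfolded o_def])
        (use wR R in force)
    then have "W holomorphic_on ball 0 1"
      unfolding W_def by (intro holomorphic_intros)
    then have "(\<lambda>z. g (W z)) holomorphic_on ball 0 1"
      by (rule holomorphic_on_compose_gen[OF _ g(1), unfolded o_def])
        (use Wball ball_subset_times_exp_image in blast)
    moreover have "g (W 0) = 0"
      using g(2)[of 0] by (simp add: W_def w psi0)
    moreover have "logderiv_q (rescale r f) z = wp (g (W z))" if "z \<in> ball 0 1" for z
      using gh(2)[OF Wball[OF that]] logderiv_q_rescale[OF fhol r(1) r1, of z] in_ball[of z] w(4) that
      by (simp add: wp_def W_def)
    moreover have "(\<lambda>z. g (W z)) ` ball 0 1 \<subseteq> ball 0 1"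
      using gh(1) Wball by blast
    ultimately have "subord (logderiv_q (rescale r f)) wp"
      unfolding subord_def by blast
    moreover have "rescale r f z \<noteq> 0" if "z \<in> ball 0 1" "z \<noteq> 0" for z
      using nz[of "of_real r * z"] in_ball[of z] that r by (simp add: rescale_def)
    ultimately show ?thesis
      using classA_rescale[OF A r(1) r1] by (simp add: starlike_class_def)
  qed
  then have good: "radius_good (starlike_class wp) (starlike_class \<psi>) R"
    by (simp add: radius_good_def)
  have "r \<le> R" if r: "0 < r" "r \<le> 1" and "radius_good (starlike_class wp) (starlike_class \<psi>) r" for r
  proof (rule ccontr)
    assume "\<not> r \<le> R"
    obtain f where f: "classA f" "\<And>z. z \<in> ball 0 1 \<Longrightarrow> z \<noteq> 0 \<Longrightarrow> f z \<noteq> 0"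
      "\<And>z. z \<in> ball 0 1 \<Longrightarrow> logderiv_q f z = \<psi> z"
      using exists_classA_logderiv_q[OF hol psi0] by blast
    have "subord (logderiv_q f) \<psi>"
      unfolding subord_def by (rule exI[of _ "\<lambda>z. z"]) (auto simp: f(3))
    then have "f \<in> starlike_class \<psi>"
      using f by (simp add: starlike_class_def)
    then have "rescale r f \<in> starlike_class wp"
      using that by (auto simp: radius_good_def)
    then obtain \<omega> where w: "\<omega> ` ball 0 1 \<subseteq> ball 0 1"
      "\<And>z. z \<in> ball 0 1 \<Longrightarrow> logderiv_q (rescale r f) z = wp (\<omega> z)"
      by (auto simp: starlike_class_def subord_def)
    \<comment> \<open>For \<open>r > R\<close> this point lies in the unit disk and is dilated to
      \<open>-R\<close>, where \<psi> takes the value omitted by \<open>wp\<close>.\<close>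
    define z where "z = - complex_of_real (R / r)"
    have z: "z \<in> ball 0 1" "of_real r * z = - of_real R"
      using \<open>\<not> r \<le> R\<close> r R by (auto simp: z_def norm_divide)
    have "wp (\<omega> z) = \<psi> (- of_real R)"
      using w(2)[OF z(1)] logderiv_q_rescale[of f r z] f(1,3) r z \<open>\<not> r \<le> R\<close> R
      by (simp add: classA_def)
    then have "\<omega> z * exp (\<omega> z) = - exp (- 1)"
      by (simp add: sharp wp_def)
    moreover have "norm (\<omega> z) < 1" using w(1) z(1) by force
    ultimately show False using times_exp_ne_minus_inverse_e by blast
  qed
  then show ?thesis using R good by (simp add: is_radius_def)
qed

subsection \<open>The six classes\<close>

text \<open>The stronger bound |psiL z - 1| < 1/e holds for |z| < R; that smaller disk touches the
  target disk from inside at 1 - 1/e. It follows from \<open>z = (s - 1) * (s + 1)\<close> for the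
  root \<open>s\<close>, since |s - 1| \<ge> 1/e would make |z| at least R.\<close>

lemma is_radius_psiL:
  "is_radius (starlike_class wp) (starlike_class psiL) ((2 * exp 1 - 1) / exp 1 ^ 2)"
proof -
  define \<epsilon> where "\<epsilon> = exp (- 1 :: real)"
  note e = exp_minus_one_bounds[folded \<epsilon>_def]
  define R where "R = 1 - (1 - \<epsilon>)\<^sup>2"
  have R_eq: "R = (2 * exp 1 - 1) / exp 1 ^ 2"
    by (simp add: R_def \<epsilon>_def exp_minus field_simps power2_eq_square)
  have R': "R = \<epsilon> * (2 - \<epsilon>)"
    by (simp add: R_def power2_eq_square algebra_simps)
  have R01: "0 < R" "R \<le> 1" using e by (simp_all add: R') (simp add: R_def flip: R')
  have "is_radius (starlike_class wp) (starlike_class psiL) R"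
  proof (rule is_radius_wpI)
    show "psiL holomorphic_on ball 0 1"
      unfolding psiL_def
    proof (intro holomorphic_intros)
      fix z :: complex assume "z \<in> ball 0 1"
      then show "1 + z \<notin> \<real>\<^sub>\<le>\<^sub>0"
        using abs_Re_le_cmod[of z] by (auto simp: complex_nonpos_Reals_iff)
    qed
    have "psiL (- of_real R) = csqrt (of_real ((1 - \<epsilon>)\<^sup>2))"
      by (simp add: psiL_def R_def)
    also have "\<dots> = of_real (1 - \<epsilon>)"
      using e by (subst csqrt_of_real_nonneg) auto
    finally show "psiL (- of_real R) = 1 - exp (- 1)"
      by (simp add: \<epsilon>_def flip: exp_of_real)
    fix z :: complex assume z: "norm z < R"
    define s where "s = csqrt (1 + z)"
    have "s\<^sup>2 = 1 + z" by (simp add: s_def)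
    then have "z = (s - 1) * (s + 1)"
      by (simp add: algebra_simps power2_eq_square)
    then have nz: "norm z = norm (s - 1) * norm (s + 1)" by (metis norm_mult)
    have "norm (s - 1) < \<epsilon>"
    proof (rule ccontr)
      assume "\<not> norm (s - 1) < \<epsilon>"
      define d where "d = norm (s - 1)"
      have d: "\<epsilon> \<le> d" using \<open>\<not> norm (s - 1) < \<epsilon>\<close> by (simp add: d_def)
      have "R \<le> norm z"
      proof (cases "d \<le> 1")
        case True
        have "2 - d \<le> norm (s + 1)"
          using norm_triangle_ineq4[of "s + 1" "s - 1"] by (simp add: d_def)
        then have "d * (2 - d) \<le> norm z"
          unfolding nz d_def[symmetric] using d e by (intro mult_left_mono) auto
        \<comment> \<open>This product is the difference of \<open>d * (2 - d)\<close> and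
          \<open>\<epsilon> * (2 - \<epsilon>)\<close>, the latter being \<open>R\<close>.\<close>
        moreover have "(d - \<epsilon>) * (2 - d - \<epsilon>) \<ge> 0"
          using d e True by (intro mult_nonneg_nonneg) auto
        ultimately show ?thesis by (simp add: R' algebra_simps)
      next
        case False
        have "0 \<le> Re s" unfolding s_def by (rule Re_csqrt)
        then have "1 \<le> norm (s + 1)"
          using abs_Re_le_cmod[of "s + 1"] by simp
        then have "1 * 1 \<le> d * norm (s + 1)"
          using False by (intro mult_mono) auto
        then show ?thesis using nz R01 by (simp add: d_def)
      qed
      then show False using z by simp
    qed
    then show "norm (psiL z - 2) < 1 + exp (- 1)"
      using norm_triangle_ineq4[of "s - 1" 1]
      by (simp add: psiL_def s_def \<epsilon>_def)
  qed (simp_all add: R01 psiL_def)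
  then show ?thesis using R_eq by simp
qed

lemma is_radius_psiRL:
  "is_radius (starlike_class wp) (starlike_class psiRL)
     ((1 + 2 * (sqrt 2 - 1) * exp 1) /
      (exp 1 ^ 2 * (sqrt 2 - 1) * (sqrt 2 - 1 + 2 * (sqrt 2 - 1 + exp (-1)) ^ 2)))"
proof -
  define \<epsilon> where "\<epsilon> = exp (- 1 :: real)"
  note e = exp_minus_one_bounds[folded \<epsilon>_def]
  define k where "k = sqrt 2 - 1"
  have k: "41 / 100 < k" "k < 42 / 100"
    using real_less_rsqrt[of "141/100" 2] real_less_lsqrt[of "142/100" 2]
    by (auto simp: k_def power2_eq_square)
  \<comment> \<open>\<open>M\<close> is the bound wanted for \<open>k * norm s\<close>, with
    \<open>s\<close> the root in \<open>psiRL\<close>; \<open>R\<close> then solves k^2 (1 + R)/(1 -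
    2kR) = M^2, that is, psiRL(-R) = 1 - 1/e.\<close>
  define M where "M = k + \<epsilon>"
  define R where "R = (M\<^sup>2 - k\<^sup>2) / (k\<^sup>2 + 2 * k * M\<^sup>2)"
  have M: "k < M" "M < 8 / 10" using e k by (auto simp: M_def)
  have M2: "k\<^sup>2 < M\<^sup>2" using M k by (intro power_strict_mono) auto
  have den: "0 < k\<^sup>2 + 2 * k * M\<^sup>2" using k M2 by (intro add_pos_nonneg) auto
  have R_eq: "R = (1 + 2 * k * exp 1) / (exp 1 ^ 2 * k * (k + 2 * (k + exp (-1)) ^ 2))"
  proof -
    have "M\<^sup>2 - k\<^sup>2 = (1 + 2 * k * exp 1) / exp 1 ^ 2"
      by (simp add: M_def \<epsilon>_def exp_minus field_simps power2_eq_square)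
    then show ?thesis by (simp add: R_def M_def \<epsilon>_def power2_eq_square algebra_simps)
  qed
  have R0: "0 < R" using M2 den by (simp add: R_def)
  have "M\<^sup>2 * (1 - 2 * k) \<le> (8 / 10)\<^sup>2 * (18 / 100)"
    using M k by (intro mult_mono power_mono) auto
  also have "\<dots> \<le> 2 * (41 / 100)\<^sup>2" by (simp add: power2_eq_square)
  also have "\<dots> \<le> 2 * k\<^sup>2" using k by (intro mult_left_mono power_mono) auto
  finally have R1: "R \<le> 1" using den by (simp add: R_def field_simps)
  have kR: "2 * k * R < 1"
    using mult_mono[of "2 * k" "84/100" R 1] k R0 R1 by simp
  have Req: "R * (k\<^sup>2 + 2 * k * M\<^sup>2) = M\<^sup>2 - k\<^sup>2" using den by (simp add: R_def)
  have "is_radius (starlike_class wp) (starlike_class psiRL) R"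
  proof (rule is_radius_wpI)
    have den_nz: "1 + 2 * complex_of_real k * z \<noteq> 0" if "norm z < 1" for z
    proof
      assume "1 + 2 * complex_of_real k * z = 0"
      then have "norm (2 * complex_of_real k * z) = 1"
        by (metis add_eq_0_iff norm_minus_cancel norm_one)
      then have "2 * k * norm z = 1" using k by (simp add: norm_mult)
      moreover have "2 * k * norm z \<le> 2 * k * 1"
        using that k by (intro mult_left_mono) auto
      ultimately show False using k by simp
    qed
    show "psiRL holomorphic_on ball 0 1"
      unfolding psiRL_def k_def[symmetric]
    proof (intro holomorphic_intros)
      fix z :: complex assume "z \<in> ball 0 1"
      then have z: "norm z < 1" by simp
      then show "1 + 2 * complex_of_real k * z \<noteq> 0" by (rule den_nz)
      \<comment> \<open>A real value l \<le> 0 of the quotient gives 1 - l = |1 + 2kl| |z|. As 0 <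
        2k < 1, the first factor on the right is at most 1 - l, which contradicts |z| < 1.\<close>
      show "(1 - z) / (1 + 2 * complex_of_real k * z) \<notin> \<real>\<^sub>\<le>\<^sub>0"
      proof
        assume "(1 - z) / (1 + 2 * complex_of_real k * z) \<in> \<real>\<^sub>\<le>\<^sub>0"
        then obtain l where l: "l \<le> 0" "(1 - z) / (1 + 2 * complex_of_real k * z) = of_real l"
          by (auto elim!: nonpos_Reals_cases)
        then have "1 - z = of_real l * (1 + 2 * complex_of_real k * z)"
          using den_nz[OF z] by (simp add: field_simps)
        then have "of_real (1 - l) = of_real (1 + 2 * k * l) * z"
          by (simp add: algebra_simps)
        then have "norm (complex_of_real (1 - l)) = norm (of_real (1 + 2 * k * l) * z)"
          by (rule arg_cong)
        then have eq: "1 - l = \<bar>1 + 2 * k * l\<bar> * norm z"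
          using l by (simp only: norm_mult norm_of_real)
        have "k * l \<le> 0" "l \<le> 2 * (k * l)"
          using l k mult_right_mono_neg[of "2 * k" 1 l] by (auto simp: mult_nonneg_nonpos)
        then have "\<bar>1 + 2 * k * l\<bar> \<le> 1 - l" using l by (auto simp: abs_if)
        then have "\<bar>1 + 2 * k * l\<bar> * norm z \<le> (1 - l) * norm z"
          by (intro mult_right_mono) auto
        also have "\<dots> < (1 - l) * 1" using l z by (intro mult_strict_left_mono) auto
        finally show False using eq by simp
      qed
    qed
    have "psiRL (- of_real R) = of_real (k + 1) - of_real k * csqrt (of_real ((1 + R) / (1 - 2 * k * R)))"
      unfolding psiRL_def k_def by simp
    also have "(1 + R) / (1 - 2 * k * R) = (M / k)\<^sup>2"
      using Req kR k by (simp add: power_divide frac_eq_eq) (simp add: algebra_simps)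
    also have "csqrt (of_real ((M / k)\<^sup>2)) = of_real (M / k)"
      using M k by (subst csqrt_of_real_nonneg) auto
    also have "of_real (k + 1) - of_real k * complex_of_real (M / k) = of_real (k + 1 - M)"
      using k by simp
    finally show "psiRL (- of_real R) = 1 - exp (- 1)"
      by (simp add: M_def \<epsilon>_def flip: exp_of_real)
    fix z :: complex assume z: "norm z < R"
    define s where "s = csqrt ((1 - z) / (1 + 2 * complex_of_real k * z))"
    have "(norm s)\<^sup>2 = norm (s\<^sup>2)" by (simp add: norm_power)
    also have "\<dots> = norm (1 - z) / norm (1 + 2 * complex_of_real k * z)"
      by (simp add: s_def norm_divide)
    \<comment> \<open>The numerator is largest and the denominator smallest at the same point
      \<open>- norm z\<close>, so the negative real axis is the worst case.\<close>
    also have "\<dots> \<le> (1 + norm z) / (1 - 2 * k * norm z)"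
    proof (rule frac_le)
      show "norm (1 - z) \<le> 1 + norm z" using norm_triangle_ineq4[of 1 z] by simp
      have "2 * k * norm z \<le> 2 * k * R" using z k by simp
      then show "0 < 1 - 2 * k * norm z" using kR by simp
      show "1 - 2 * k * norm z \<le> norm (1 + 2 * complex_of_real k * z)"
        using norm_diff_ineq[of 1 "2 * complex_of_real k * z"] k by (simp add: norm_mult)
    qed simp
    also have "\<dots> < (M / k)\<^sup>2"
    proof -
      have "2 * k * norm z \<le> 2 * k * R" using z k by simp
      then have p: "0 < 1 - 2 * k * norm z" using kR by simp
      have "norm z * (k\<^sup>2 + 2 * k * M\<^sup>2) < R * (k\<^sup>2 + 2 * k * M\<^sup>2)"
        using z den by (intro mult_strict_right_mono)
      then have "(1 + norm z) * k\<^sup>2 < M\<^sup>2 * (1 - 2 * k * norm z)"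
        unfolding Req by (simp add: algebra_simps)
      then show ?thesis using p k by (simp add: divide_less_eq field_simps)
    qed
    finally have "norm s < M / k" using M k by (auto intro: power2_less_imp_less)
    then have "k * norm s < M" using k by (simp add: field_simps)
    \<comment> \<open>\<open>\<bar>psiRL z - 1 - k\<bar> = k \<bar>s\<bar> < k + 1/e\<close> is a smaller disk touching the target disk at \<open>1 - 1/e\<close>.\<close>
    moreover have "psiRL z - 2 = - (of_real k * s) - of_real (1 - k)"
      by (simp add: psiRL_def s_def k_def)
    then have "norm (psiRL z - 2) \<le> k * norm s + (1 - k)"
      using norm_triangle_ineq4[of "- (of_real k * s)" "of_real (1 - k)"] k
      by (simp only: norm_minus_cancel norm_mult norm_of_real)
    ultimately show "norm (psiRL z - 2) < 1 + exp (- 1)"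
      by (simp add: M_def \<epsilon>_def)
  qed (use R0 R1 in \<open>simp_all add: psiRL_def\<close>)
  then show ?thesis using R_eq by (simp add: k_def)
qed

text \<open>Writing z = x + iy, |exp z - 2|^2 is bounded through cos y \<ge> 1 - y^2/2 and y^2 < R^2
  - x^2 by \<open>F x + 4\<close>. Since \<open>F\<close> decreases from -R to x, the bound is at
  most its value at -R, which is exactly (1 + 1/e)^2.\<close>

lemma is_radius_psiE:
  "is_radius (starlike_class wp) (starlike_class psiE) (1 - ln (exp 1 - 1))"
proof -
  define R :: real where "R = 1 - ln (exp 1 - 1)"
  have eR: "exp (- R) = 1 - exp (- 1)"
  proof -
    have "exp (- R) = (exp 1 - 1) / exp 1"
      using exp_one_gt by (simp add: R_def exp_diff)
    then show ?thesis by (simp add: exp_minus diff_divide_distrib inverse_eq_divide)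
  qed
  then have "exp (- R) < 1" using exp_minus_one_bounds(1) by linarith
  then have "R > 0" by simp
  \<comment> \<open>This leads to \<open>R < 1 / 2\<close>, which together with
    \<open>exp R < 8 / 5\<close> fixes the sign of the derivative of \<open>F\<close>.\<close>
  have "exp (1 / 2 :: real) < 17 / 10"
  proof (rule power2_less_imp_less)
    show "(exp (1 / 2 :: real))\<^sup>2 < (17 / 10)\<^sup>2"
      using e_less_272 by (simp add: power2_eq_square flip: exp_add)
  qed simp
  then have "exp (1 / 2 :: real) < exp 1 - 1" using exp_one_gt by linarith
  then have "ln (exp (1 / 2)) < ln (exp 1 - 1 :: real)"
    using exp_one_gt by (subst ln_less_cancel_iff) auto
  then have "R < 1 / 2" by (simp add: R_def)
  have expR: "exp R < 8 / 5"
  proof -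
    have "17 / 27 < exp (- R)" using eR exp_minus_one_bounds(3) by linarith
    then have "exp R * (17 / 27) < exp R * exp (- R)" by (intro mult_strict_left_mono) auto
    then show ?thesis by (simp flip: exp_add)
  qed
  have "is_radius (starlike_class wp) (starlike_class psiE) R"
  proof (rule is_radius_wpI)
    show "psiE holomorphic_on ball 0 1"
      unfolding psiE_def by (intro holomorphic_intros)
    have "psiE (- of_real R) = of_real (exp (- R))"
      by (simp add: psiE_def flip: exp_of_real)
    then show "psiE (- of_real R) = 1 - exp (- 1)"
      by (simp add: eR flip: exp_of_real)
    fix z :: complex assume z: "norm z < R"
    define x y where "x = Re z" and "y = Im z"
    have "(norm z)\<^sup>2 < R\<^sup>2" using z by (intro power_strict_mono) auto
    then have xy: "y\<^sup>2 < R\<^sup>2 - x\<^sup>2" by (simp add: cmod_power2 x_def y_def)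
    have x: "- R \<le> x" "x \<le> R" using z abs_Re_le_cmod[of z] by (auto simp: x_def)
    define F where "F = (\<lambda>x. exp x * exp x - 4 * exp x + 2 * exp x * (R\<^sup>2 - x\<^sup>2))"
    have "F x \<le> F (- R)"
    proof (rule DERIV_nonpos_imp_nonincreasing[OF x(1)])
      fix t assume t: "- R \<le> t" "t \<le> x"
      \<comment> \<open>This is the derivative of \<open>F\<close> up to the positive factor
        \<open>2 * exp t\<close>. For t \<le> 0 one has 1 + t \<ge> 1 - R > R; for t > 0 the crude
        bounds 8/5 and 1/4 add up to less than 2.\<close>
      have "exp t - 2 + R\<^sup>2 - t\<^sup>2 - 2 * t \<le> 0"
      proof (cases "t \<le> 0")
        case True
        have "R\<^sup>2 \<le> (1 + t)\<^sup>2" using t \<open>R > 0\<close> \<open>R < 1 / 2\<close> by (intro power_mono) auto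
        moreover have "(1 + t)\<^sup>2 = 1 + 2 * t + t\<^sup>2" by (simp add: power2_eq_square algebra_simps)
        moreover have "exp t \<le> 1" using True by simp
        ultimately show ?thesis by linarith
      next
        case False
        have "exp t \<le> exp R" using t x by simp
        moreover have "R\<^sup>2 \<le> 1 / 4"
          using \<open>R > 0\<close> \<open>R < 1 / 2\<close> power_mono[of R "1 / 2" 2] by (simp add: power2_eq_square)
        moreover have "t\<^sup>2 \<ge> 0" by simp
        ultimately show ?thesis using expR False by linarith
      qed
      then have "2 * exp t * (exp t - 2 + R\<^sup>2 - t\<^sup>2 - 2 * t) \<le> 0"
        by (intro mult_nonneg_nonpos) auto
      moreover have "(F has_real_derivative 2 * exp t * (exp t - 2 + R\<^sup>2 - t\<^sup>2 - 2 * t)) (at t)"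
        unfolding F_def by (auto intro!: derivative_eq_intros simp: algebra_simps)
      ultimately show "\<exists>d. (F has_real_derivative d) (at t) \<and> d \<le> 0" by blast
    qed
    have "(norm (exp z - 2))\<^sup>2 = (exp x * cos y - 2)\<^sup>2 + (exp x * sin y)\<^sup>2"
      by (simp add: cmod_power2 Re_exp Im_exp x_def y_def)
    also have "\<dots> = exp x * exp x * ((sin y)\<^sup>2 + (cos y)\<^sup>2) - 4 * exp x * cos y + 4"
      by (simp add: power2_eq_square algebra_simps del: sin_cos_squared_add sin_cos_squared_add2 sin_cos_squared_add3)
    also have "\<dots> = exp x * exp x - 4 * exp x * cos y + 4" by simp
    also have "\<dots> \<le> exp x * exp x - 4 * exp x * (1 - y\<^sup>2 / 2) + 4"
      using cos_ge_quadratic[of y] by simp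
    also have "\<dots> = exp x * exp x - 4 * exp x + 2 * exp x * y\<^sup>2 + 4"
      by (simp add: algebra_simps)
    also have "\<dots> < F x + 4" using xy by (simp add: F_def)
    also have "\<dots> \<le> F (- R) + 4" using \<open>F x \<le> F (- R)\<close> by simp
    also have "\<dots> = (1 + exp (- 1))\<^sup>2"
      by (simp add: F_def eR power2_eq_square algebra_simps)
    finally show "norm (psiE z - 2) < 1 + exp (- 1)"
      unfolding psiE_def by (rule power2_less_imp_less) simp
  qed (use \<open>R > 0\<close> \<open>R < 1 / 2\<close> in \<open>simp_all add: psiE_def\<close>)
  then show ?thesis by (simp add: R_def)
qed

text \<open>On each circle |z| = r < R the distance from \<open>psiC z\<close> to 2 is largest at z
  = -r, where it is 1 + 2/3 (2r - r^2). This increases with r and reaches 1 + 1/e at r = R.\<close>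

lemma is_radius_psiC:
  "is_radius (starlike_class wp) (starlike_class psiC) (1 - sqrt (1 - 3 / (2 * exp 1)))"
proof -
  define \<epsilon> where "\<epsilon> = exp (- 1 :: real)"
  note e = exp_minus_one_bounds[folded \<epsilon>_def]
  define R :: real where "R = 1 - sqrt (1 - 3 / 2 * \<epsilon>)"
  have "3 / 2 * \<epsilon> = 3 / (2 * exp 1)"
    by (simp add: \<epsilon>_def exp_minus inverse_eq_divide)
  then have R_eq: "R = 1 - sqrt (1 - 3 / (2 * exp 1))"
    by (simp add: R_def)
  have "R > 0" using e by (simp add: R_def)
  have "3 / 5 < sqrt (1 - 3 / 2 * \<epsilon>)"
    using e by (intro real_less_rsqrt) (simp add: power2_eq_square)
  then have "R < 2 / 5" by (simp add: R_def)
  have "(1 - R)\<^sup>2 = 1 - 3 / 2 * \<epsilon>" using e by (simp add: R_def)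
  then have Req: "2 * R - R\<^sup>2 = 3 / 2 * \<epsilon>" by (simp add: power2_eq_square algebra_simps)
  have "is_radius (starlike_class wp) (starlike_class psiC) R"
  proof (rule is_radius_wpI)
    show "psiC holomorphic_on ball 0 1"
      unfolding psiC_def by (intro holomorphic_intros)
    have "psiC (- of_real R) = of_real (1 - 2 / 3 * (2 * R - R\<^sup>2))"
      by (simp add: psiC_def algebra_simps)
    then show "psiC (- of_real R) = 1 - exp (- 1)"
      by (simp add: Req \<epsilon>_def flip: exp_of_real)
    fix z :: complex assume z: "norm z < R"
    define x y r where "x = Re z" and "y = Im z" and "r = norm z"
    have r: "r < R" "0 \<le> r" "- r \<le> x" "x \<le> r"
      using z abs_Re_le_cmod[of z] by (auto simp: r_def x_def)
    have y2: "y\<^sup>2 = r\<^sup>2 - x\<^sup>2" by (simp add: r_def x_def y_def cmod_power2)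
    have "(norm (psiC z - 2))\<^sup>2 = (4/3 * x + 2/3 * (x\<^sup>2 - y\<^sup>2) - 1)\<^sup>2 + (4/3 * y + 4/3 * x * y)\<^sup>2"
      unfolding cmod_power2 by (simp add: psiC_def x_def y_def Re_power2 Im_power2 algebra_simps diff_divide_distrib)
    also have "(4/3 * y + 4/3 * x * y)\<^sup>2 = (4/3 + 4/3 * x)\<^sup>2 * y\<^sup>2"
      by (simp add: power2_eq_square algebra_simps)
    \<comment> \<open>Eliminating y^2 leaves the squared value at z = -r minus a multiple of x + r,
      whose cofactor is nonnegative because r < 2/5.\<close>
    also have "(4/3 * x + 2/3 * (x\<^sup>2 - y\<^sup>2) - 1)\<^sup>2 + (4/3 + 4/3 * x)\<^sup>2 * y\<^sup>2
      = (1 + 2/3 * (2 * r - r\<^sup>2))\<^sup>2 - (x + r) * (8/3 * (1 + (x - r)) - 16/9 * r\<^sup>2)"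
      unfolding y2 by (simp add: power2_eq_square field_simps)
    also have "\<dots> \<le> (1 + 2/3 * (2 * r - r\<^sup>2))\<^sup>2"
    proof -
      have "r\<^sup>2 \<le> (2/5)\<^sup>2" using r \<open>R < 2/5\<close> by (intro power_mono) auto
      then have "16/9 * r\<^sup>2 \<le> 8/3 * (1 + (x - r))"
        using r \<open>R < 2/5\<close> by (simp add: power2_eq_square)
      then have "0 \<le> (x + r) * (8/3 * (1 + (x - r)) - 16/9 * r\<^sup>2)"
        using r by (intro mult_nonneg_nonneg) auto
      then show ?thesis by simp
    qed
    also have "\<dots> < (1 + \<epsilon>)\<^sup>2"
    proof (rule power_strict_mono)
      have "0 < (R - r) * (2 - R - r)"
        using r \<open>R < 2/5\<close> by (intro mult_pos_pos) auto
      then have "2 * r - r\<^sup>2 < 2 * R - R\<^sup>2" by (simp add: power2_eq_square algebra_simps)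
      then show "1 + 2/3 * (2 * r - r\<^sup>2) < 1 + \<epsilon>" unfolding Req by simp
      have "0 \<le> r * (2 - r)" using r \<open>R < 2/5\<close> by (intro mult_nonneg_nonneg) auto
      then show "0 \<le> 1 + 2/3 * (2 * r - r\<^sup>2)" by (simp add: power2_eq_square algebra_simps)
    qed simp
    finally show "norm (psiC z - 2) < 1 + exp (- 1)"
      unfolding \<epsilon>_def by (rule power2_less_imp_less) simp
  qed (use \<open>R > 0\<close> \<open>R < 2/5\<close> in \<open>simp_all add: psiC_def\<close>)
  then show ?thesis using R_eq by simp
qed

text \<open>The coefficient 3/4 is the mean of 1 and 1/2, the quadratic coefficients in the upper
  bounds used for \<open>exp t\<close> and \<open>exp (- t)\<close>.\<close>

lemma cosh_le_quadratic:
  fixes y :: real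
  assumes "\<bar>y\<bar> \<le> 1"
  shows "cosh y \<le> 1 + 3 / 4 * y\<^sup>2"
proof -
  define t where "t = \<bar>y\<bar>"
  have t: "0 \<le> t" "t \<le> 1" "t\<^sup>2 = y\<^sup>2" using assms by (auto simp: t_def)
  have "exp (- t) * (1 + t + t\<^sup>2 / 2) \<le> exp (- t) * exp t"
    using t exp_lower_Taylor_quadratic[of t] by (intro mult_left_mono) auto
  also have "\<dots> = 1" by (simp flip: exp_add)
  also have "1 \<le> 1 + (t\<^sup>2 / 2)\<^sup>2" by simp
  also have "\<dots> = (1 - t + t\<^sup>2 / 2) * (1 + t + t\<^sup>2 / 2)"
    by (simp add: field_simps power2_eq_square)
  finally have "exp (- t) \<le> 1 - t + t\<^sup>2 / 2"
    using t by (simp add: add_pos_nonneg)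
  moreover have "exp t \<le> 1 + t + t\<^sup>2" using t by (intro exp_bound) auto
  moreover have "cosh y = (exp t + exp (- t)) / 2"
    by (simp add: t_def cosh_def abs_if)
  ultimately show ?thesis using t(3) by (simp add: field_simps)
qed

text \<open>Here |sin z - 1| equals cosh y - sin x exactly. With r = |z|, the excess of cosh y over
  1 is at most 3/4 (r + x), while sin r + sin x is at least 7/8 (r + x); hence the distance is at
  most 1 + sin r.\<close>

lemma is_radius_psiS:
  "is_radius (starlike_class wp) (starlike_class psiS) (arcsin (1 / exp 1))"
proof -
  define \<epsilon> where "\<epsilon> = exp (- 1 :: real)"
  note e = exp_minus_one_bounds[folded \<epsilon>_def]
  define R :: real where "R = arcsin \<epsilon>"
  have R_eq: "R = arcsin (1 / exp 1)" by (simp add: R_def \<epsilon>_def exp_minus inverse_eq_divide)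
  have sinR: "sin R = \<epsilon>" using e by (simp add: R_def)
  have "R > 0" using e arcsin_less_arcsin[of 0 \<epsilon>] by (simp add: R_def)
  \<comment> \<open>On [-1/2, 1/2] the derivative of \<open>sin\<close> is at least 1 - 1/8. The
    same slope also yields \<open>R < 1/2\<close>, since sin(1/2) \<ge> 7/16 > 1/e.\<close>
  have sin_diff: "7/8 * (b - a) \<le> sin b - sin a" if "a \<le> b" "- 1/2 \<le> a" "b \<le> 1/2" for a b :: real
  proof -
    have "sin a - 7/8 * a \<le> sin b - 7/8 * b"
    proof (rule DERIV_nonneg_imp_nondecreasing[OF that(1)])
      fix t assume t: "a \<le> t" "t \<le> b"
      then have "t\<^sup>2 \<le> (1/2)\<^sup>2" using that by (intro abs_le_square_iff[THEN iffD1]) auto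
      then have "7/8 \<le> cos t" using cos_ge_quadratic[of t] by (simp add: power2_eq_square)
      moreover have "((\<lambda>t. sin t - 7/8 * t) has_real_derivative cos t - 7/8) (at t)"
        by (auto intro!: derivative_eq_intros)
      ultimately show "\<exists>d. ((\<lambda>t. sin t - 7/8 * t) has_real_derivative d) (at t) \<and> 0 \<le> d"
        by (intro exI[of _ "cos t - 7/8"]) auto
    qed
    then show ?thesis by (simp add: field_simps)
  qed
  have "R < 1/2"
  proof -
    have "\<epsilon> < sin (1/2)" using e sin_diff[of 0 "1/2"] by simp
    then have "R < arcsin (sin (1/2))" unfolding R_def using e by (intro arcsin_less_arcsin) auto
    also have "\<dots> = 1/2" using pi_gt3 by (intro arcsin_sin) auto
    finally show ?thesis .
  qed
  have "is_radius (starlike_class wp) (starlike_class psiS) R"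
  proof (rule is_radius_wpI)
    show "psiS holomorphic_on ball 0 1"
      unfolding psiS_def by (intro holomorphic_intros)
    have "psiS (- of_real R) = of_real (1 - sin R)"
      by (simp add: psiS_def sin_of_real)
    then show "psiS (- of_real R) = 1 - exp (- 1)"
      by (simp add: sinR \<epsilon>_def flip: exp_of_real)
    fix z :: complex assume z: "norm z < R"
    define x y r where "x = Re z" and "y = Im z" and "r = norm z"
    have r: "r < R" "0 \<le> r" "- r \<le> x" "x \<le> r" "\<bar>y\<bar> \<le> r"
      using z abs_Re_le_cmod[of z] abs_Im_le_cmod[of z] by (auto simp: r_def x_def y_def)
    have y2: "y\<^sup>2 = (r + x) * (r - x)"
      using cmod_power2[of z] by (simp add: r_def x_def y_def power2_eq_square algebra_simps)
    have "(norm (sin z - 1))\<^sup>2 = (sin x * cosh y - 1)\<^sup>2 + (cos x * sinh y)\<^sup>2"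
      by (simp add: cmod_power2 Re_sin Im_sin x_def y_def cosh_def sinh_def)
    also have "\<dots> = (sin x)\<^sup>2 * (cosh y)\<^sup>2 - 2 * sin x * cosh y + 1 + (1 - (sin x)\<^sup>2) * ((cosh y)\<^sup>2 - 1)"
      by (simp add: power_mult_distrib cos_squared_eq sinh_square_eq power2_eq_square[of "sin x * cosh y - 1"])
         (simp add: power2_eq_square algebra_simps)
    also have "\<dots> = (cosh y - sin x)\<^sup>2"
      by (simp add: power2_eq_square algebra_simps)
    finally have "norm (sin z - 1) = \<bar>cosh y - sin x\<bar>"
      by (metis abs_norm_cancel power2_eq_iff abs_minus_cancel)
    also have "\<dots> = cosh y - sin x"
      using cosh_real_ge_1[of y] sin_le_one[of x] by linarith
    also have "\<dots> \<le> 1 + 3/4 * y\<^sup>2 - sin x"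
      using cosh_le_quadratic[of y] r \<open>R < 1/2\<close> by simp
    also have "y\<^sup>2 \<le> (r + x) * 1"
      unfolding y2 using r \<open>R < 1/2\<close> by (intro mult_left_mono) auto
    also have "1 + 3/4 * ((r + x) * 1) - sin x \<le> 1 + sin r"
      using sin_diff[of "- x" r] r \<open>R < 1/2\<close> by (simp add: field_simps)
    also have "\<dots> < 1 + sin R"
      using r \<open>R < 1/2\<close> pi_gt3 by (simp add: sin_mono_less_eq)
    finally show "norm (psiS z - 2) < 1 + exp (- 1)"
      by (simp add: psiS_def sinR \<epsilon>_def algebra_simps)
  qed (use \<open>R > 0\<close> \<open>R < 1/2\<close> in \<open>simp_all add: psiS_def\<close>)
  then show ?thesis using R_eq by simp
qed

text \<open>The value s = psiDelta z satisfies z = (s - 1/s)/2, so |z| is expressed through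
  \<open>P\<close> = |s|^2 and \<open>x\<close> = Re s. It is shown that |s - 2| \<ge> 2 - b, with b
  = 1 - 1/e, forces |z| \<ge> R.\<close>

lemma is_radius_psiDelta:
  "is_radius (starlike_class wp) (starlike_class psiDelta)
     ((2 * exp 1 - 1) / (2 * exp 1 * (exp 1 - 1)))"
proof -
  define b where "b = 1 - exp (- 1 :: real)"
  have b: "17 / 27 < b" "b < 16 / 25"
    using exp_minus_one_bounds by (auto simp: b_def)
  \<comment> \<open>This is (1/b - b)/2, so that 1 + R^2 is the square of (1/b + b)/2 and
    psiDelta(-R) = b.\<close>
  define R where "R = (1 - b\<^sup>2) / (2 * b)"
  have R_eq: "R = (2 * exp 1 - 1) / (2 * exp 1 * (exp 1 - 1))"
    using exp_one_gt by (simp add: R_def b_def exp_minus field_simps power2_eq_square)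
  have b2: "b\<^sup>2 < 1" using b by (intro power_less_one_iff[THEN iffD2]) auto
  have R0: "R > 0" using b b2 by (simp add: R_def)
  have "(17/27)\<^sup>2 \<le> b\<^sup>2" using b by (intro power_mono) auto
  then have R1: "R < 1" using b by (simp add: R_def power2_eq_square)
  have "is_radius (starlike_class wp) (starlike_class psiDelta) R"
  proof (rule is_radius_wpI)
    show "psiDelta holomorphic_on ball 0 1"
      unfolding psiDelta_def
    proof (intro holomorphic_intros)
      fix z :: complex assume "z \<in> ball 0 1"
      then have "norm (z\<^sup>2) < 1" by (simp add: norm_power power_less_one_iff)
      then show "1 + z\<^sup>2 \<notin> \<real>\<^sub>\<le>\<^sub>0"
        using abs_Re_le_cmod[of "z\<^sup>2"] by (auto simp: complex_nonpos_Reals_iff)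
    qed
    have "1 + R\<^sup>2 = ((1 + b\<^sup>2) / (2 * b))\<^sup>2"
      using b by (simp add: R_def field_simps) (simp add: power2_eq_square algebra_simps)
    moreover have "1 + (- complex_of_real R)\<^sup>2 = of_real (1 + R\<^sup>2)" by simp
    ultimately have "psiDelta (- of_real R) = - of_real R + csqrt (of_real (((1 + b\<^sup>2) / (2 * b))\<^sup>2))"
      by (simp only: psiDelta_def)
    also have "csqrt (of_real (((1 + b\<^sup>2) / (2 * b))\<^sup>2)) = of_real ((1 + b\<^sup>2) / (2 * b))"
      using b by (subst csqrt_of_real_nonneg) auto
    also have "- of_real R + complex_of_real ((1 + b\<^sup>2) / (2 * b)) = of_real ((1 + b\<^sup>2) / (2 * b) - R)"
      by simp
    also have "(1 + b\<^sup>2) / (2 * b) - R = b"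
      using b by (simp add: R_def field_simps power2_eq_square)
    finally show "psiDelta (- of_real R) = 1 - exp (- 1)"
      by (simp add: b_def flip: exp_of_real)
    fix z :: complex assume z: "norm z < R"
    define q where "q = csqrt (1 + z\<^sup>2)"
    define s where "s = z + q"
    have q2: "q\<^sup>2 = 1 + z\<^sup>2" by (simp add: q_def)
    have Req: "0 \<le> Re q" unfolding q_def by (rule Re_csqrt)
    have st: "s * (q - z) = 1" using q2 by (simp add: s_def power2_eq_square algebra_simps)
    have sz: "s\<^sup>2 - 1 = 2 * (z * s)" using st by (simp add: s_def power2_eq_square algebra_simps)
    define x P where "x = Re s" and "P = (norm s)\<^sup>2"
    have "s \<noteq> 0" using st by auto
    then have "P > 0" by (simp add: P_def)
    \<comment> \<open>As \<open>q - z\<close> is the reciprocal of \<open>s\<close>,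
      \<open>cnj s\<close> equals P (q - z). Adding P s = P (q + z) and taking real parts leaves 2 P
      Re q \<ge> 0. The sign allows \<open>x4\<close> to be squared later.\<close>
    have "x \<ge> 0"
    proof -
      have "of_real P = s * cnj s" unfolding P_def by (rule complex_norm_square)
      then have "cnj s = of_real P * (q - z)" using st by (metis mult.assoc mult.commute mult.left_neutral)
      then have "Re (cnj s) = P * Re (q - z)" by simp
      then have "x + x * P = 2 * P * Re q" by (simp add: x_def s_def algebra_simps)
      then have "0 \<le> x * (1 + P)" using Req \<open>P > 0\<close> by (simp add: algebra_simps)
      then show ?thesis using \<open>P > 0\<close> by (simp add: zero_le_mult_iff)
    qed
    have Pxy: "P = x\<^sup>2 + (Im s)\<^sup>2" by (simp add: P_def x_def cmod_power2)
    have "4 * (norm z)\<^sup>2 * P = (norm (s\<^sup>2 - 1))\<^sup>2"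
      by (simp add: sz norm_mult power_mult_distrib P_def)
    also have "\<dots> = (P + 1)\<^sup>2 - 4 * x\<^sup>2"
      unfolding Pxy cmod_power2 by (simp add: x_def power2_eq_square algebra_simps)
    finally have zP: "4 * (norm z)\<^sup>2 * P = (P + 1)\<^sup>2 - 4 * x\<^sup>2" .
    have "(norm (s - 2))\<^sup>2 < (2 - b)\<^sup>2"
    proof (rule ccontr)
      assume "\<not> (norm (s - 2))\<^sup>2 < (2 - b)\<^sup>2"
      moreover have "(norm (s - 2))\<^sup>2 = P - 4 * x + 4"
        unfolding Pxy cmod_power2 by (simp add: x_def power2_eq_square algebra_simps)
      ultimately have x4: "4 * x \<le> P + 4 * b - b\<^sup>2"
        by (simp add: power2_eq_square algebra_simps)
      \<comment> \<open>In view of \<open>zP\<close>, this is R^2 \<le> |z|^2 with denominators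
        cleared.\<close>
      have "P * (1 - b\<^sup>2)\<^sup>2 \<le> b\<^sup>2 * ((P + 1)\<^sup>2 - 4 * x\<^sup>2)"
      proof (cases "P \<le> b\<^sup>2")
        case True
        \<comment> \<open>For small |s| the trivial bound x^2 \<le> P is enough: the resulting
          difference factors into two nonpositive terms.\<close>
        have "P * b\<^sup>2 \<le> 1 * 1" using True b2 \<open>P > 0\<close> by (intro mult_mono) auto
        then have "0 \<le> (P - b\<^sup>2) * (b\<^sup>2 * P - 1)"
          using True by (intro mult_nonpos_nonpos) (auto simp: mult.commute)
        moreover have "(P - b\<^sup>2) * (b\<^sup>2 * P - 1) = b\<^sup>2 * ((P + 1)\<^sup>2 - 4 * P) - P * (1 - b\<^sup>2)\<^sup>2"
          by (simp add: power2_eq_square algebra_simps)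
        moreover have "b\<^sup>2 * ((P + 1)\<^sup>2 - 4 * P) \<le> b\<^sup>2 * ((P + 1)\<^sup>2 - 4 * x\<^sup>2)"
          using Pxy by (intro mult_left_mono) auto
        ultimately show ?thesis by linarith
      next
        case False
        \<comment> \<open>For P > b^2 the assumed distance from 2 bounds \<open>x\<close>. The
          difference again has the factor P - b^2, and its cofactor is nonnegative because b (4 - b)
          \<ge> 2.\<close>
        have "(4 * x)\<^sup>2 \<le> (P + 4 * b - b\<^sup>2)\<^sup>2" using x4 \<open>x \<ge> 0\<close> by (intro power_mono) auto
        then have "b\<^sup>2 * (4 * (P + 1)\<^sup>2 - (P + 4 * b - b\<^sup>2)\<^sup>2) \<le> b\<^sup>2 * (4 * ((P + 1)\<^sup>2 - 4 * x\<^sup>2))"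
          by (intro mult_left_mono) (auto simp: power_mult_distrib)
        moreover have "b\<^sup>2 * (4 * (P + 1)\<^sup>2 - (P + 4 * b - b\<^sup>2)\<^sup>2) - 4 * (P * (1 - b\<^sup>2)\<^sup>2)
          = (P - b\<^sup>2) * (3 * b\<^sup>2 * P + ((b * (4 - b))\<^sup>2 - 2\<^sup>2))"
          by (simp add: power2_eq_square algebra_simps)
        moreover have "0 \<le> (P - b\<^sup>2) * (3 * b\<^sup>2 * P + ((b * (4 - b))\<^sup>2 - 2\<^sup>2))"
        proof -
          have "2 \<le> (17/27) * (4 - 16/25 :: real)" by simp
          also have "\<dots> \<le> b * (4 - b)" using b by (intro mult_mono) auto
          finally have "2\<^sup>2 \<le> (b * (4 - b))\<^sup>2" by (intro power_mono) auto
          then show ?thesis using False \<open>P > 0\<close>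
            by (intro mult_nonneg_nonneg add_nonneg_nonneg) auto
        qed
        ultimately show ?thesis by linarith
      qed
      also have "\<dots> = 4 * (norm z)\<^sup>2 * b\<^sup>2 * P" by (simp flip: zP)
      finally have "P * (1 - b\<^sup>2)\<^sup>2 \<le> P * (4 * (norm z)\<^sup>2 * b\<^sup>2)" by (simp add: mult_ac)
      then have "(1 - b\<^sup>2)\<^sup>2 \<le> (2 * b * norm z)\<^sup>2" using \<open>P > 0\<close> by (simp add: power_mult_distrib mult_ac)
      then have "1 - b\<^sup>2 \<le> 2 * b * norm z" by (rule power2_le_imp_le) (use b in simp)
      then have "R \<le> norm z" using b by (simp add: R_def divide_le_eq mult_ac)
      then show False using z by simp
    qed
    then have "norm (s - 2) < 2 - b" by (rule power2_less_imp_less) (use b in simp)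
    then show "norm (psiDelta z - 2) < 1 + exp (- 1)"
      by (simp add: psiDelta_def s_def q_def b_def)
  qed (use R0 R1 in \<open>simp_all add: psiDelta_def\<close>)
  then show ?thesis using R_eq by simp
qed

theorem mainTheorem11:
  shows "is_radius (starlike_class wp) (starlike_class psiL) ((2 * exp 1 - 1) / exp 1 ^ 2)
    \<and> is_radius (starlike_class wp) (starlike_class psiRL)
        ((1 + 2 * (sqrt 2 - 1) * exp 1) /
         (exp 1 ^ 2 * (sqrt 2 - 1) * (sqrt 2 - 1 + 2 * (sqrt 2 - 1 + exp (-1)) ^ 2)))
    \<and> is_radius (starlike_class wp) (starlike_class psiE) (1 - ln (exp 1 - 1))
    \<and> is_radius (starlike_class wp) (starlike_class psiC) (1 - sqrt (1 - 3 / (2 * exp 1)))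
    \<and> is_radius (starlike_class wp) (starlike_class psiS) (arcsin (1 / exp 1))
    \<and> is_radius (starlike_class wp) (starlike_class psiDelta)
        ((2 * exp 1 - 1) / (2 * exp 1 * (exp 1 - 1)))"
  by (intro conjI is_radius_psiL is_radius_psiRL is_radius_psiE is_radius_psiC is_radius_psiS
      is_radius_psiDelta)

end
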